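(* Let $\alpha=\alpha(t)$, $t\in I_1$, and $\omega=\omega(s)$, $s\in I_2$, be regular planar curves with values in $\mathbb{C}\setminus\{0\}$ ($I_1,I_2$ intervals of $\mathbb{R}$), and let $\Phi=\alpha\ast\omega$ be the associated Lagrangian immersion. Then $\Phi$ is Hamiltonian stationary Lagrangian if and only if there are $a,b,c\in\mathbb{R}$ such that the curvature functions $\kappa_\alpha$ and $\kappa_\omega$ of $\alpha$ and $\omega$ are given by $$\kappa_\alpha(t)=at+b,\qquad \kappa_\omega(s)=-as+c,$$ where $t$ and $s$ are the arclength parameters of $\alpha$ and $\omega$, respectively.
   Context: For base points $t_0\in I_1,s_0\in I_2$, $$(\alpha\ast\omega)(t,s)=\left(\int_{s_0}^s\dot\omega(y)\overline{\omega(y)}\,dy-\int_{t_0}^t\alpha'(x)\overline{\alpha(x)}\,dx\, ,\ \alpha(t)\omega(s)\right)\in\mathbb{C}^2,$$ where $'$ and $\dot{}$ denote derivatives in $t$ and $s$; changing base points only changes the map by a translation. It is a Lagrangian immersion (the Kaehler form $-\mathrm{Im}(z_1\bar w_1+z_2\bar w_2)$ pulls back to zero) with induced metric $(|\alpha|^2+|\omega|^2)(|\alpha'|^2dt^2+|\dot\omega|^2ds^2)$. $\kappa_\alpha,\kappa_\omega$ are the signed curvatures, so $(\arg\alpha')'=|\alpha'|\kappa_\alpha$ and $(\arg\dot\omega)\dot{}=|\dot\omega|\kappa_\omega$. The Lagrangian angle $\beta$ (with values in $\mathbb{R}/2\pi\mathbb{Z}$) of a Lagrangian immersion $\Phi$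 of an oriented surface $M$ with area form $\omega_M$ is defined by $\Phi^*(dz_1\wedge dz_2)=e^{i\beta}\omega_M$. The immersion is called Hamiltonian stationary if $\Delta\beta=0$, with $\Delta$ the Laplace operator of the induced metric. *)

theory Defs
  imports "HOL-Analysis.Analysis"
begin

section \<open>Curves\<close>

text \<open>All derivatives are taken within the parameter interval, so intervals may contain endpoints
  (where the derivative is one-sided). Intervals are required to be nondegenerate, which makes
  these derivatives unique.\<close>

definition nondeg_interval :: "real set \<Rightarrow> bool" where
  "nondeg_interval I \<longleftrightarrow> is_interval I \<and> (\<exists>x\<in>I. \<exists>y\<in>I. x < y)"

definition D :: "real set \<Rightarrow> (real \<Rightarrow> 'a::real_normed_vector) \<Rightarrow> real \<Rightarrow> 'a" where
  "D I f t = vector_derivative f (at t within I)"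

definition smooth_curve :: "real set \<Rightarrow> (real \<Rightarrow> 'a::real_normed_vector) \<Rightarrow> bool" where
  "smooth_curve I f \<longleftrightarrow> (\<forall>n. \<forall>t\<in>I. ((D I ^^ n) f) differentiable (at t within I))"

definition regular_curve :: "real set \<Rightarrow> (real \<Rightarrow> complex) \<Rightarrow> bool" where
  "regular_curve I f \<longleftrightarrow> smooth_curve I f \<and> (\<forall>t\<in>I. D I f t \<noteq> 0)"

text \<open>The numerator is the determinant of the real vectors \<open>f'\<close> and \<open>f''\<close>. The sign is the one for
  which the derivative of \<open>arg f'\<close> is \<open>\<bar>f'\<bar>\<close> times the curvature.\<close>

definition signed_curvature :: "real set \<Rightarrow> (real \<Rightarrow> complex) \<Rightarrow> real \<Rightarrow> real" where
  "signed_curvature I f t = Im (cnj (D I f t) * D I (D I f) t) / norm (D I f t) ^ 3"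

text \<open>Arclength parameters are determined up to an additive constant. The identity is
  one exactly if the curve has unit speed.\<close>

definition arclength_parameter :: "real set \<Rightarrow> (real \<Rightarrow> complex) \<Rightarrow> (real \<Rightarrow> real) \<Rightarrow> bool" where
  "arclength_parameter I f \<sigma> \<longleftrightarrow>
     (\<forall>t\<in>I. (\<sigma> has_real_derivative norm (D I f t)) (at t within I))"


section \<open>Surfaces in complex 2-space parametrized over a product of intervals\<close>

definition D1 :: "real set \<Rightarrow> (real \<Rightarrow> real \<Rightarrow> 'a::real_normed_vector) \<Rightarrow> real \<Rightarrow> real \<Rightarrow> 'a" where
  "D1 I f t s = vector_derivative (\<lambda>x. f x s) (at t within I)"

definition D2 :: "real set \<Rightarrow> (real \<Rightarrow> real \<Rightarrow> 'a::real_normed_vector) \<Rightarrow> real \<Rightarrow> real \<Rightarrow> 'a" where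
  "D2 J f t s = vector_derivative (\<lambda>y. f t y) (at s within J)"

primrec Ck_map :: "nat \<Rightarrow> real set \<Rightarrow> real set \<Rightarrow>
    (real \<Rightarrow> real \<Rightarrow> 'a::real_normed_vector) \<Rightarrow> bool" where
  "Ck_map 0 I J f \<longleftrightarrow> continuous_on (I \<times> J) (\<lambda>(t, s). f t s)"
| "Ck_map (Suc k) I J f \<longleftrightarrow>
     continuous_on (I \<times> J) (\<lambda>(t, s). f t s) \<and>
     (\<forall>t\<in>I. \<forall>s\<in>J. (\<lambda>x. f x s) differentiable (at t within I) \<and>
                  (\<lambda>y. f t y) differentiable (at s within J)) \<and>
     Ck_map k I J (D1 I f) \<and> Ck_map k I J (D2 J f)"

definition smooth_map :: "real set \<Rightarrow> real set \<Rightarrow>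
    (real \<Rightarrow> real \<Rightarrow> 'a::real_normed_vector) \<Rightarrow> bool" where
  "smooth_map I J f \<longleftrightarrow> (\<forall>k. Ck_map k I J f)"

definition immersion :: "real set \<Rightarrow> real set \<Rightarrow>
    (real \<Rightarrow> real \<Rightarrow> 'a::real_normed_vector) \<Rightarrow> bool" where
  "immersion I J \<Phi> \<longleftrightarrow> smooth_map I J \<Phi> \<and>
     (\<forall>t\<in>I. \<forall>s\<in>J. inj (\<lambda>(x, y). x *\<^sub>R D1 I \<Phi> t s + y *\<^sub>R D2 J \<Phi> t s))"

definition kaehler_form :: "complex \<times> complex \<Rightarrow> complex \<times> complex \<Rightarrow> real" where
  "kaehler_form z w = - Im (fst z * cnj (fst w) + snd z * cnj (snd w))"

text \<open>\<open>dz\<^sub>1 \<and> dz\<^sub>2\<close>\<close>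

definition complex_volume_form :: "complex \<times> complex \<Rightarrow> complex \<times> complex \<Rightarrow> complex" where
  "complex_volume_form z w = fst z * snd w - snd z * fst w"

text \<open>A 2-form on \<open>I \<times> J\<close> is given by its value on the pair of coordinate fields, so pulling a
  2-form back amounts to evaluating it on the partial derivatives of \<open>\<Phi>\<close>.\<close>

definition lagrangian_immersion :: "real set \<Rightarrow> real set \<Rightarrow>
    (real \<Rightarrow> real \<Rightarrow> complex \<times> complex) \<Rightarrow> bool" where
  "lagrangian_immersion I J \<Phi> \<longleftrightarrow> immersion I J \<Phi> \<and>
     (\<forall>t\<in>I. \<forall>s\<in>J. kaehler_form (D1 I \<Phi> t s) (D2 J \<Phi> t s) = 0)"

text \<open>Coefficients of the induced metric \<open>E dt\<^sup>2 + 2 F dt ds + G ds\<^sup>2\<close>. The inner product on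
  \<^typ>\<open>complex \<times> complex\<close> is the Euclidean one, \<open>Re (z\<^sub>1 cnj w\<^sub>1 + z\<^sub>2 cnj w\<^sub>2)\<close>.\<close>

definition metric_E :: "real set \<Rightarrow> real set \<Rightarrow>
    (real \<Rightarrow> real \<Rightarrow> complex \<times> complex) \<Rightarrow> real \<Rightarrow> real \<Rightarrow> real" where
  "metric_E I J \<Phi> t s = D1 I \<Phi> t s \<bullet> D1 I \<Phi> t s"

definition metric_F :: "real set \<Rightarrow> real set \<Rightarrow>
    (real \<Rightarrow> real \<Rightarrow> complex \<times> complex) \<Rightarrow> real \<Rightarrow> real \<Rightarrow> real" where
  "metric_F I J \<Phi> t s = D1 I \<Phi> t s \<bullet> D2 J \<Phi> t s"

definition metric_G :: "real set \<Rightarrow> real set \<Rightarrow>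
    (real \<Rightarrow> real \<Rightarrow> complex \<times> complex) \<Rightarrow> real \<Rightarrow> real \<Rightarrow> real" where
  "metric_G I J \<Phi> t s = D2 J \<Phi> t s \<bullet> D2 J \<Phi> t s"

text \<open>The area form of the induced metric is \<open>area_density dt \<and> ds\<close>; that is, \<open>I \<times> J\<close> carries its
  standard orientation.\<close>

definition area_density :: "real set \<Rightarrow> real set \<Rightarrow>
    (real \<Rightarrow> real \<Rightarrow> complex \<times> complex) \<Rightarrow> real \<Rightarrow> real \<Rightarrow> real" where
  "area_density I J \<Phi> t s =
     sqrt (metric_E I J \<Phi> t s * metric_G I J \<Phi> t s - (metric_F I J \<Phi> t s)\<^sup>2)"

text \<open>The Laplace-Beltrami operator \<open>g\<^bsup>-1/2\<^esup> \<partial>\<^sub>i (g\<^bsup>1/2\<^esup> g\<^bsup>ij\<^esup> \<partial>\<^sub>j f)\<close> of the induced metric, written out with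
  the inverse matrix of \<open>((E, F), (F, G))\<close>.\<close>

definition laplacian :: "real set \<Rightarrow> real set \<Rightarrow>
    (real \<Rightarrow> real \<Rightarrow> complex \<times> complex) \<Rightarrow> (real \<Rightarrow> real \<Rightarrow> real) \<Rightarrow> real \<Rightarrow> real \<Rightarrow> real" where
  "laplacian I J \<Phi> f t s =
     (D1 I (\<lambda>t s. (metric_G I J \<Phi> t s * D1 I f t s - metric_F I J \<Phi> t s * D2 J f t s)
                   / area_density I J \<Phi> t s) t s
      + D2 J (\<lambda>t s. (metric_E I J \<Phi> t s * D2 J f t s - metric_F I J \<Phi> t s * D1 I f t s)
                   / area_density I J \<Phi> t s) t s)
     / area_density I J \<Phi> t s"

text \<open>The Lagrangian angle has values in \<open>\<real>/2\<pi>\<int>\<close>. Over the simply connected domain \<open>I \<times> J\<close> it is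
  represented by a continuous real-valued lift \<open>\<beta>\<close>, which is unique up to an additive constant in
  \<open>2\<pi>\<int>\<close> and automatically smooth because \<open>\<Phi>\<close> is; its Laplacian is thus that of the angle.\<close>

definition lagrangian_angle :: "real set \<Rightarrow> real set \<Rightarrow>
    (real \<Rightarrow> real \<Rightarrow> complex \<times> complex) \<Rightarrow> (real \<Rightarrow> real \<Rightarrow> real) \<Rightarrow> bool" where
  "lagrangian_angle I J \<Phi> \<beta> \<longleftrightarrow> continuous_on (I \<times> J) (\<lambda>(t, s). \<beta> t s) \<and>
     (\<forall>t\<in>I. \<forall>s\<in>J. complex_volume_form (D1 I \<Phi> t s) (D2 J \<Phi> t s)
                  = exp (\<i> * of_real (\<beta> t s)) * of_real (area_density I J \<Phi> t s))"

definition hamiltonian_stationary_lagrangian :: "real set \<Rightarrow> real set \<Rightarrow>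
    (real \<Rightarrow> real \<Rightarrow> complex \<times> complex) \<Rightarrow> bool" where
  "hamiltonian_stationary_lagrangian I J \<Phi> \<longleftrightarrow> lagrangian_immersion I J \<Phi> \<and>
     (\<exists>\<beta>. lagrangian_angle I J \<Phi> \<beta> \<and> (\<forall>t\<in>I. \<forall>s\<in>J. laplacian I J \<Phi> \<beta> t s = 0))"


section \<open>The surface associated with a pair of planar curves\<close>

text \<open>The interval integrals are oriented: they change sign when the limits are swapped.\<close>

definition curve_product :: "real set \<Rightarrow> real set \<Rightarrow> real \<Rightarrow> real \<Rightarrow>
    (real \<Rightarrow> complex) \<Rightarrow> (real \<Rightarrow> complex) \<Rightarrow> real \<Rightarrow> real \<Rightarrow> complex \<times> complex" where
  "curve_product I J t0 s0 \<alpha> \<omega> t s =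
     ((LBINT y=ereal s0..ereal s. D J \<omega> y * cnj (\<omega> y))
        - (LBINT x=ereal t0..ereal t. D I \<alpha> x * cnj (\<alpha> x)),
      \<alpha> t * \<omega> s)"

end

theory Submission
  imports Defs
begin

text \<open>The partial derivatives of \<open>\<Phi>\<close> are \<open>\<alpha>' (-cnj \<alpha>, \<omega>)\<close> and \<open>\<omega>' (cnj \<omega>, \<alpha>)\<close>. They are Hermitian orthogonal,
  the metric is conformal to \<open>\<bar>\<alpha>'\<bar>\<^sup>2 dt\<^sup>2 + \<bar>\<omega>'\<bar>\<^sup>2 ds\<^sup>2\<close>, and the Lagrangian angle is
  \<open>\<pi> + arg \<alpha>' + arg \<omega>'\<close>. The conformal factor cancels in the divergence form of the Laplacian, so
  \<open>\<Delta>\<beta> = 0\<close> says that the arclength derivative of \<open>\<kappa>\<^sub>\<alpha>\<close>, a function of \<open>t\<close> only, is minus that of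
  \<open>\<kappa>\<^sub>\<omega>\<close>, a function of \<open>s\<close> only. Both are therefore constant.\<close>

section \<open>Derivatives within an interval\<close>

text \<open>A connected set with more than one point has no isolated points. This makes derivatives
  within the interval unique, at endpoints too, so that \<open>D\<close> can be computed from any
  \<open>has_vector_derivative\<close> fact.\<close>

lemma nondeg_interval_at_within_neq_bot:
  assumes "nondeg_interval I" "t \<in> I"
  shows "at t within I \<noteq> bot"
proof -
  have "connected I" "\<nexists>a. I = {a}"
    using assms(1) unfolding nondeg_interval_def by (auto simp: is_interval_connected)
  then have "t islimpt I"
    using connected_imp_perfect assms(2) by blast
  then show ?thesis
    by (simp add: trivial_limit_within)
qed

lemma has_vector_derivative_D:
  "f differentiable (at t within I) \<Longrightarrow> (f has_vector_derivative D I f t) (at t within I)"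
  unfolding D_def using vector_derivative_works by blast

lemma D_eqI:
  assumes "nondeg_interval I" "t \<in> I" "(f has_vector_derivative d) (at t within I)"
  shows "D I f t = d"
  unfolding D_def
  using vector_derivative_within[OF nondeg_interval_at_within_neq_bot[OF assms(1,2)] assms(3)] .

lemma has_vector_derivative_cong_on:
  assumes "\<And>x. x \<in> I \<Longrightarrow> f x = g x" "t \<in> I"
  shows "(f has_vector_derivative d) (at t within I) \<longleftrightarrow> (g has_vector_derivative d) (at t within I)"
  using has_vector_derivative_transform[of t I f g] has_vector_derivative_transform[of t I g f] assms
  by auto

lemma vector_derivative_cong_on:
  assumes "\<And>x. x \<in> I \<Longrightarrow> f x = g x" "t \<in> I"
  shows "vector_derivative f (at t within I) = vector_derivative g (at t within I)"
  unfolding vector_derivative_def using has_vector_derivative_cong_on[of I f g t, OF assms] by simp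

lemma differentiable_cong_on:
  assumes "\<And>x. x \<in> I \<Longrightarrow> f x = g x" "t \<in> I"
  shows "f differentiable (at t within I) \<longleftrightarrow> g differentiable (at t within I)"
  using has_derivative_transform[of t I f g] has_derivative_transform[of t I g f] assms
  unfolding differentiable_def by metis

section \<open>Smooth curves and their closure properties\<close>

text \<open>Splitting smoothness by finite order makes induction possible. At order 0 nothing is
  required, which gives trivial base cases.\<close>

definition differentiable_upto :: "nat \<Rightarrow> real set \<Rightarrow> (real \<Rightarrow> 'a::real_normed_vector) \<Rightarrow> bool" where
  "differentiable_upto n I f \<longleftrightarrow> (\<forall>k<n. \<forall>t\<in>I. ((D I ^^ k) f) differentiable (at t within I))"

lemma smooth_curve_iff_upto: "smooth_curve I f \<longleftrightarrow> (\<forall>n. differentiable_upto n I f)"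
  unfolding smooth_curve_def differentiable_upto_def by blast

lemma differentiable_upto_0 [simp]: "differentiable_upto 0 I f"
  by (simp add: differentiable_upto_def)

text \<open>Peels off the innermost derivative, so that an induction hypothesis for arbitrary
  functions can be applied to \<open>D I f\<close>.\<close>

lemma differentiable_upto_Suc:
  "differentiable_upto (Suc n) I f \<longleftrightarrow>
     (\<forall>t\<in>I. f differentiable (at t within I)) \<and> differentiable_upto n I (D I f)"
  unfolding differentiable_upto_def
  by (simp add: All_less_Suc2 funpow_swap1 del: funpow.simps)
     (simp add: funpow_Suc_right del: funpow.simps)

lemma differentiable_upto_Suc_imp: "differentiable_upto (Suc n) I f \<Longrightarrow> differentiable_upto n I f"
  by (simp add: differentiable_upto_def)

text \<open>Formulas for \<open>D I f\<close> are available only at points of \<open>I\<close>.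
  Agreement there suffices, because derivatives within \<open>I\<close> ignore all other
  values.\<close>

lemma differentiable_upto_cong:
  assumes "\<And>x. x \<in> I \<Longrightarrow> f x = g x" "differentiable_upto n I f"
  shows "differentiable_upto n I g"
  using assms
proof (induction n arbitrary: f g)
  case (Suc n)
  have "D I f x = D I g x" if "x \<in> I" for x
    unfolding D_def using vector_derivative_cong_on[of I f g x] Suc.prems(1) that by blast
  then show ?case
    using Suc.IH[of "D I f" "D I g"] Suc.prems differentiable_cong_on[of I f g]
    by (simp add: differentiable_upto_Suc)
qed simp

text \<open>The induction step of the closure proofs: an explicit derivative \<open>f'\<close> may
  stand in for \<open>D I f\<close>.\<close>

lemma differentiable_upto_SucI:
  assumes "nondeg_interval I"
    and "\<And>t. t \<in> I \<Longrightarrow> (f has_vector_derivative f' t) (at t within I)"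
    and "differentiable_upto n I f'"
  shows "differentiable_upto (Suc n) I f"
  unfolding differentiable_upto_Suc
proof
  show "\<forall>t\<in>I. f differentiable (at t within I)"
    using assms(2) by (auto intro: differentiableI_vector)
  show "differentiable_upto n I (D I f)"
    by (rule differentiable_upto_cong[OF _ assms(3)]) (use D_eqI[OF assms(1)] assms(2) in fastforce)
qed

lemma differentiable_upto_add:
  assumes "nondeg_interval I" "differentiable_upto n I f" "differentiable_upto n I g"
  shows "differentiable_upto n I (\<lambda>t. f t + g t)"
  using assms(2,3)
proof (induction n arbitrary: f g)
  case (Suc n)
  show ?case
    by (rule differentiable_upto_SucI[OF assms(1), where f' = "\<lambda>t. D I f t + D I g t"])
       (use Suc in \<open>auto simp: differentiable_upto_Suc intro!: derivative_intros has_vector_derivative_D\<close>)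
qed simp

text \<open>The product rule yields a sum of products of functions that still have \<open>n\<close>
  derivatives, so the induction hypothesis covers both summands.\<close>

lemma differentiable_upto_mult:
  fixes f g :: "real \<Rightarrow> complex"
  assumes "nondeg_interval I" "differentiable_upto n I f" "differentiable_upto n I g"
  shows "differentiable_upto n I (\<lambda>t. f t * g t)"
  using assms(2,3)
proof (induction n arbitrary: f g)
  case (Suc n)
  show ?case
  proof (rule differentiable_upto_SucI[OF assms(1), where f' = "\<lambda>t. f t * D I g t + D I f t * g t"])
    show "((\<lambda>t. f t * g t) has_vector_derivative f t * D I g t + D I f t * g t) (at t within I)"
      if "t \<in> I" for t
      using Suc.prems that
      by (intro has_vector_derivative_mult has_vector_derivative_D) (auto simp: differentiable_upto_Suc)
    show "differentiable_upto n I (\<lambda>t. f t * D I g t + D I f t * g t)"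
      using Suc.prems Suc.prems[THEN differentiable_upto_Suc_imp]
      by (intro differentiable_upto_add[OF assms(1)] Suc.IH) (auto simp: differentiable_upto_Suc)
  qed
qed simp

lemma differentiable_upto_bounded_linear:
  assumes "nondeg_interval I" "bounded_linear h" "differentiable_upto n I f"
  shows "differentiable_upto n I (\<lambda>t. h (f t))"
  using assms(3)
proof (induction n arbitrary: f)
  case (Suc n)
  show ?case
    by (rule differentiable_upto_SucI[OF assms(1), where f' = "\<lambda>t. h (D I f t)"])
       (use Suc in \<open>auto simp: differentiable_upto_Suc
          intro!: bounded_linear.has_vector_derivative[OF assms(2)] has_vector_derivative_D\<close>)
qed simp

lemma smooth_curve_differentiable:
  "smooth_curve I f \<Longrightarrow> t \<in> I \<Longrightarrow> f differentiable (at t within I)"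
  unfolding smooth_curve_def by (metis funpow_0)

lemma smooth_curve_D: "smooth_curve I f \<Longrightarrow> smooth_curve I (D I f)"
  using differentiable_upto_Suc smooth_curve_iff_upto by metis

lemma smooth_curve_continuous_on: "smooth_curve I f \<Longrightarrow> continuous_on I f"
  by (simp add: continuous_on_eq_continuous_within smooth_curve_differentiable
      differentiable_imp_continuous_within)

lemma smooth_curve_mult:
  fixes f g :: "real \<Rightarrow> complex"
  assumes "nondeg_interval I" "smooth_curve I f" "smooth_curve I g"
  shows "smooth_curve I (\<lambda>t. f t * g t)"
  using assms differentiable_upto_mult unfolding smooth_curve_iff_upto by blast

lemma smooth_curve_bounded_linear:
  assumes "nondeg_interval I" "bounded_linear h" "smooth_curve I f"
  shows "smooth_curve I (\<lambda>t. h (f t))"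
  using assms differentiable_upto_bounded_linear unfolding smooth_curve_iff_upto by blast

lemma smooth_curve_antiderivative:
  assumes "nondeg_interval I" "smooth_curve I f'"
    and "\<And>t. t \<in> I \<Longrightarrow> (f has_vector_derivative f' t) (at t within I)"
  shows "smooth_curve I f"
  unfolding smooth_curve_iff_upto
  using differentiable_upto_SucI[OF assms(1,3)] assms(2) differentiable_upto_Suc_imp
  unfolding smooth_curve_iff_upto by blast

lemma smooth_curve_zero: "nondeg_interval I \<Longrightarrow> smooth_curve I (\<lambda>t. 0)"
proof -
  assume I: "nondeg_interval I"
  have "differentiable_upto n I (\<lambda>t. 0)" for n
    by (induction n) (auto intro!: differentiable_upto_SucI[OF I])
  then show ?thesis unfolding smooth_curve_iff_upto by blast
qed

section \<open>Smoothness of maps of two variables\<close>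

lemma Ck_map_cong:
  assumes "\<And>t s. t \<in> I \<Longrightarrow> s \<in> J \<Longrightarrow> f t s = g t s" "Ck_map k I J f"
  shows "Ck_map k I J g"
  using assms
proof (induction k arbitrary: f g)
  case 0
  then show ?case
    by (auto elim!: continuous_on_eq)
next
  case (Suc k)
  have 1: "D1 I f t s = D1 I g t s" if "t \<in> I" "s \<in> J" for t s
    unfolding D1_def using vector_derivative_cong_on[of I "\<lambda>x. f x s" "\<lambda>x. g x s" t] Suc.prems(1) that by blast
  have 2: "D2 J f t s = D2 J g t s" if "t \<in> I" "s \<in> J" for t s
    unfolding D2_def using vector_derivative_cong_on[of J "\<lambda>y. f t y" "\<lambda>y. g t y" s] Suc.prems(1) that by blast
  have 3: "continuous_on (I \<times> J) (\<lambda>(t, s). g t s)"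
    using Suc.prems by (auto elim!: continuous_on_eq)
  have 4: "(\<lambda>x. g x s) differentiable (at t within I)" if "t \<in> I" "s \<in> J" for t s
    using differentiable_cong_on[of I "\<lambda>x. f x s" "\<lambda>x. g x s" t] Suc.prems that by auto
  have 5: "(\<lambda>y. g t y) differentiable (at s within J)" if "t \<in> I" "s \<in> J" for t s
    using differentiable_cong_on[of J "\<lambda>y. f t y" "\<lambda>y. g t y" s] Suc.prems that by auto
  show ?case
    using Suc.IH[OF 1] Suc.IH[OF 2] Suc.prems(2) 3 4 5 by simp
qed

text \<open>Maps of this shape are closed under both partial derivatives.\<close>

lemma smooth_map_separated:
  fixes p q g h :: "real \<Rightarrow> complex"
  assumes I: "nondeg_interval I" and J: "nondeg_interval J"
    and "smooth_curve I p" "smooth_curve J q" "smooth_curve I g" "smooth_curve J h"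
  shows "smooth_map I J (\<lambda>t s. (p t + q s, g t * h s))"
proof -
  have "Ck_map k I J (\<lambda>t s. (p t + q s, g t * h s))" for k
    using assms(3-)
  proof (induction k arbitrary: p q g h)
    case 0
    have c: "continuous_on I p" "continuous_on J q" "continuous_on I g" "continuous_on J h"
      using 0 smooth_curve_continuous_on by blast+
    show ?case
      by (auto simp: case_prod_beta intro!: continuous_intros
          continuous_on_compose2[OF c(1)] continuous_on_compose2[OF c(2)]
          continuous_on_compose2[OF c(3)] continuous_on_compose2[OF c(4)])
  next
    case (Suc k)
    have c: "continuous_on I p" "continuous_on J q" "continuous_on I g" "continuous_on J h"
      using Suc.prems smooth_curve_continuous_on by blast+
    have cont: "continuous_on (I \<times> J) (\<lambda>(t, s). (p t + q s, g t * h s))"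
      by (auto simp: case_prod_beta intro!: continuous_intros
          continuous_on_compose2[OF c(1)] continuous_on_compose2[OF c(2)]
          continuous_on_compose2[OF c(3)] continuous_on_compose2[OF c(4)])
    note d = Suc.prems[THEN smooth_curve_differentiable, THEN has_vector_derivative_D]
    \<comment> \<open>The summand \<open>0\<close> is left in place on purpose: with the zero
      function as a second summand the derivative keeps the separated shape to which the induction
      hypothesis applies.\<close>
    have 1: "((\<lambda>x. (p x + q s, g x * h s)) has_vector_derivative
        (D I p t + 0, D I g t * h s)) (at t within I)" if "t \<in> I" for t s
      using d(1)[OF that] d(3)[OF that] by (auto intro!: derivative_eq_intros has_vector_derivative_Pair)
    have 2: "((\<lambda>y. (p t + q y, g t * h y)) has_vector_derivative
        (0 + D J q s, g t * D J h s)) (at s within J)" if "s \<in> J" for t s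
      using d(2)[OF that] d(4)[OF that] by (auto intro!: derivative_eq_intros has_vector_derivative_Pair)
    have e1: "D1 I (\<lambda>t s. (p t + q s, g t * h s)) t s = (D I p t + 0, D I g t * h s)" if "t \<in> I" for t s
      using D_eqI[OF I that 1[OF that]] by (simp add: D1_def D_def)
    have e2: "D2 J (\<lambda>t s. (p t + q s, g t * h s)) t s = (0 + D J q s, g t * D J h s)" if "s \<in> J" for t s
      using D_eqI[OF J that 2[OF that]] by (simp add: D2_def D_def)
    have "Ck_map k I J (\<lambda>t s. (D I p t + 0, D I g t * h s))"
      using Suc.prems by (intro Suc.IH smooth_curve_D smooth_curve_zero J)
    then have "Ck_map k I J (D1 I (\<lambda>t s. (p t + q s, g t * h s)))"
      by (rule Ck_map_cong[rotated]) (simp only: e1)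
    moreover have "Ck_map k I J (\<lambda>t s. (0 + D J q s, g t * D J h s))"
      using Suc.prems by (intro Suc.IH smooth_curve_D smooth_curve_zero I)
    then have "Ck_map k I J (D2 J (\<lambda>t s. (p t + q s, g t * h s)))"
      by (rule Ck_map_cong[rotated]) (simp only: e2)
    moreover have "(\<lambda>x. (p x + q s, g x * h s)) differentiable (at t within I)" if "t \<in> I" for t s
      by (rule differentiableI_vector[OF 1[OF that]])
    moreover have "(\<lambda>y. (p t + q y, g t * h y)) differentiable (at s within J)" if "s \<in> J" for t s
      by (rule differentiableI_vector[OF 2[OF that]])
    ultimately show ?case
      using cont unfolding Ck_map.simps by blast
  qed
  then show ?thesis by (simp add: smooth_map_def)
qed

section \<open>Antiderivatives on arbitrary intervals\<close>

text \<open>\<open>interval_integral_FTC2\<close> speaks of a compact interval, while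
  \<open>I\<close> may be open, half-open or unbounded. Differentiability is local, so a compact
  part of \<open>I\<close> that contains \<open>t0\<close> and agrees with \<open>I\<close> near
  \<open>t\<close> suffices.\<close>

lemma interval_lebesgue_integral_has_vector_derivative:
  fixes f :: "real \<Rightarrow> 'a::euclidean_space"
  assumes "is_interval I" "continuous_on I f" "t0 \<in> I" "t \<in> I"
  shows "((\<lambda>u. LBINT x=ereal t0..ereal u. f x) has_vector_derivative f t) (at t within I)"
proof -
  \<comment> \<open>\<open>a\<close> is the left end of the compact part; to the right of
    \<open>a'\<close> no point of \<open>I\<close> is cut off. If \<open>t\<close> is the left
    endpoint of \<open>I\<close>, then \<open>a\<close> is \<open>t\<close> itself and
    \<open>a'\<close> is any smaller number. The right end is chosen symmetrically.\<close>
  obtain a a' where a: "a \<in> I" "a \<le> t0" "a \<le> t" "a' < t" "\<And>x. x \<in> I \<Longrightarrow> a' < x \<Longrightarrow> a \<le> x"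
  proof (cases "\<exists>y\<in>I. y < t")
    case True
    then obtain y where y: "y \<in> I" "y < t" by blast
    show ?thesis
      by (rule that[of "min y t0" y]) (use y assms in \<open>auto simp: min_def\<close>)
  next
    case False
    then show ?thesis
      by (intro that[of t "t - 1"]) (use assms in \<open>auto simp: not_less\<close>)
  qed
  obtain b b' where b: "b \<in> I" "t0 \<le> b" "t \<le> b" "t < b'" "\<And>x. x \<in> I \<Longrightarrow> x < b' \<Longrightarrow> x \<le> b"
  proof (cases "\<exists>y\<in>I. y > t")
    case True
    then obtain y where y: "y \<in> I" "y > t" by blast
    show ?thesis
      by (rule that[of "max y t0" y]) (use y assms in \<open>auto simp: max_def\<close>)
  next
    case False
    then show ?thesis
      by (intro that[of t "t + 1"]) (use assms in \<open>auto simp: not_less\<close>)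
  qed
  have sub: "{a..b} \<subseteq> I"
    using assms(1) a(1) b(1) by (meson atLeastAtMost_iff mem_is_interval_1_I subsetI)
  \<comment> \<open>Inside the open neighbourhood \<open>{a'<..<b'}\<close> of \<open>t\<close> the
    two sets coincide.\<close>
  have "at t within I = at t within {a..b}"
    by (rule at_within_nhd[of t "{a'<..<b'}"]) (use a b sub in auto)
  then show ?thesis
    using interval_integral_FTC2[of a t0 b f t] a b continuous_on_subset[OF assms(2) sub] by simp
qed

section \<open>Curvature, tangent angle and arclength\<close>

text \<open>Regularity enters twice: the norm is differentiable away from 0, and the denominator
  does not vanish.\<close>

lemma signed_curvature_differentiable:
  assumes "regular_curve I f" "t \<in> I"
  shows "signed_curvature I f differentiable (at t within I)"
proof -
  have sm: "smooth_curve I (D I f)" "smooth_curve I (D I (D I f))" "D I f t \<noteq> 0"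
    using assms smooth_curve_D unfolding regular_curve_def by blast+
  have d: "D I f differentiable (at t within I)" "D I (D I f) differentiable (at t within I)"
    using sm assms(2) smooth_curve_differentiable by blast+
  have "(\<lambda>t. norm (D I f t)) differentiable (at t within I)"
    using differentiable_compose[OF differentiable_norm_at[OF sm(3)] d(1)] .
  moreover have "(\<lambda>t. Im (cnj (D I f t) * D I (D I f) t)) differentiable (at t within I)"
    by (rule differentiableI_vector[OF bounded_linear.has_vector_derivative[OF bounded_linear_Im]],
        rule has_vector_derivative_mult[OF has_vector_derivative_cnj])
      (use d in \<open>auto intro: has_vector_derivative_D\<close>)
  ultimately show ?thesis
    using sm(3) unfolding signed_curvature_def[abs_def] by (intro differentiable_divide differentiable_power) auto
qed

text \<open>The unit tangent \<open>u = f' / \<bar>f'\<bar>\<close> satisfies \<open>u' = i \<kappa> \<bar>f'\<bar> u\<close>; hence \<open>u e\<^bsup>-i\<theta>\<^esup>\<close> is constant for any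
  antiderivative \<open>\<theta>\<close> of \<open>\<kappa> \<bar>f'\<bar>\<close>.\<close>

lemma tangent_angle_exists:
  assumes I: "nondeg_interval I" and reg: "regular_curve I f"
  obtains \<theta> where
    "\<And>t. t \<in> I \<Longrightarrow> (\<theta> has_real_derivative signed_curvature I f t * norm (D I f t)) (at t within I)"
    "\<And>t. t \<in> I \<Longrightarrow> D I f t = of_real (norm (D I f t)) * cis (\<theta> t)"
proof -
  let ?v = "D I f" and ?k = "signed_curvature I f"
  have int: "is_interval I" and "I \<noteq> {}"
    using I unfolding nondeg_interval_def by auto
  then obtain t1 where t1: "t1 \<in> I" by blast
  have nz: "?v t \<noteq> 0" if "t \<in> I" for t
    using reg that unfolding regular_curve_def by blast
  have smv: "smooth_curve I ?v"
    using reg smooth_curve_D unfolding regular_curve_def by blast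
  have dv: "(?v has_vector_derivative D I ?v t) (at t within I)" if "t \<in> I" for t
    using smv that by (intro has_vector_derivative_D smooth_curve_differentiable)
  have "continuous_on I (\<lambda>t. ?k t * norm (?v t))"
    using smooth_curve_continuous_on[OF smv] signed_curvature_differentiable[OF reg]
    by (intro continuous_intros)
      (simp_all add: continuous_on_eq_continuous_within differentiable_imp_continuous_within)
  then obtain \<phi> where
    \<phi>: "\<And>t. t \<in> I \<Longrightarrow> (\<phi> has_real_derivative ?k t * norm (?v t)) (at t within I)"
    using interval_lebesgue_integral_has_vector_derivative[OF int _ t1]
    unfolding has_real_derivative_iff_has_vector_derivative by blast
  \<comment> \<open>This is the unit tangent already multiplied by the factor exp(-i \<phi>), that
    is, the product whose constancy is to be shown.\<close>
  define u where "u t = (1 / norm (?v t)) *\<^sub>R ?v t * exp (- \<i> * of_real (\<phi> t))" for t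
  have "(u has_vector_derivative 0) (at t within I)" if t: "t \<in> I" for t
  proof -
    let ?n = "norm (?v t)"
    have n: "((\<lambda>t. norm (?v t)) has_real_derivative D I ?v t \<bullet> sgn (?v t)) (at t within I)"
      using has_derivative_compose[OF dv[OF t, unfolded has_vector_derivative_def]
          has_derivative_norm[OF nz[OF t]]]
      by (simp add: has_field_derivative_def mult_commute_abs)
    have e: "((\<lambda>t. exp (- \<i> * of_real (\<phi> t))) has_vector_derivative
        (- \<i> * of_real (?k t * ?n)) * exp (- \<i> * of_real (\<phi> t))) (at t within I)"
    proof -
      have "((\<lambda>t. - \<i> * of_real (\<phi> t)) has_vector_derivative - \<i> * of_real (?k t * ?n)) (at t within I)"
        using \<phi>[OF t] by (intro derivative_intros)
      then show ?thesis
        using field_vector_diff_chain_within[of "\<lambda>t. - \<i> * of_real (\<phi> t)" _ t I exp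
          "exp (- \<i> * of_real (\<phi> t))"] DERIV_exp has_field_derivative_at_within
        by (fastforce simp: o_def)
    qed
    have nn: "?n \<noteq> 0" using nz[OF t] by simp
    have "((\<lambda>t. (1 / norm (?v t)) *\<^sub>R ?v t) has_vector_derivative
        (1 / ?n) *\<^sub>R D I ?v t + (- (D I ?v t \<bullet> sgn (?v t)) / ?n^2) *\<^sub>R ?v t) (at t within I)"
      using n dv[OF t] nn
      by (auto intro!: derivative_eq_intros simp: power2_eq_square divide_simps)
    \<comment> \<open>Differentiating the unit tangent removes from the derivative of
      \<open>?v\<close> its component along \<open>?v\<close>. In coordinates, with
      \<open>?n\<^sup>2 = x\<^sup>2 + y\<^sup>2\<close>, what remains of (p, q) is a multiple of
      (-y, x) with coefficient x q - y p, the numerator of the curvature.\<close>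
    moreover have "(1 / ?n) *\<^sub>R D I ?v t + (- (D I ?v t \<bullet> sgn (?v t)) / ?n^2) *\<^sub>R ?v t
        = \<i> * of_real (?k t * ?n) * ((1 / ?n) *\<^sub>R ?v t)"
    proof -
      define x y p q where "x = Re (?v t)" "y = Im (?v t)" "p = Re (D I ?v t)" "q = Im (D I ?v t)"
      have v: "?v t = Complex x y" "D I ?v t = Complex p q"
        by (simp_all add: x_y_p_q_def)
      have nsq: "?n\<^sup>2 = x\<^sup>2 + y\<^sup>2"
        by (simp add: v cmod_power2)
      have "D I ?v t \<bullet> sgn (?v t) = (p * x + q * y) / ?n"
        by (simp add: v inner_complex_def sgn_div_norm divide_inverse algebra_simps)
      moreover have "?k t * ?n = (x * q - y * p) / ?n\<^sup>2"
        using nn by (simp add: signed_curvature_def v power2_eq_square power3_eq_cube)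
      moreover have "p / ?n - (p * x + q * y) / ?n / ?n\<^sup>2 * x = - ((x * q - y * p) / ?n\<^sup>2) * (y / ?n)"
        "q / ?n - (p * x + q * y) / ?n / ?n\<^sup>2 * y = (x * q - y * p) / ?n\<^sup>2 * (x / ?n)"
      proof -
        have "p * ?n\<^sup>2 - (p * x + q * y) * x = - (x * q - y * p) * y"
          "q * ?n\<^sup>2 - (p * x + q * y) * y = (x * q - y * p) * x"
          unfolding nsq by algebra+
        then show "p / ?n - (p * x + q * y) / ?n / ?n\<^sup>2 * x = - ((x * q - y * p) / ?n\<^sup>2) * (y / ?n)"
          "q / ?n - (p * x + q * y) / ?n / ?n\<^sup>2 * y = (x * q - y * p) / ?n\<^sup>2 * (x / ?n)"
          using nn by (simp_all add: divide_simps) (simp_all add: algebra_simps)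
      qed
      ultimately show ?thesis
        by (simp add: complex_eq_iff v)
    qed
    ultimately have "((\<lambda>t. (1 / norm (?v t)) *\<^sub>R ?v t) has_vector_derivative
        \<i> * of_real (?k t * ?n) * ((1 / ?n) *\<^sub>R ?v t)) (at t within I)"
      by simp
    from has_vector_derivative_mult[OF this e] show ?thesis
      unfolding u_def[abs_def] by (rule has_vector_derivative_eq_rhs) (simp only: algebra_simps, simp)
  qed
  then obtain c where c: "\<And>t. t \<in> I \<Longrightarrow> u t = c"
    using has_vector_derivative_zero_constant[of I u] int is_interval_convex by blast
  \<comment> \<open>The constant is unimodular, hence equal to \<open>cis (Arg c)\<close>. Adding
    \<open>Arg c\<close> to \<open>\<phi>\<close> fixes the free constant of the antiderivative so
    that it becomes a tangent angle.\<close>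
  have "norm c = 1"
    using c[OF t1] nz[OF t1] by (auto simp: u_def norm_mult)
  then have cis_c: "cis (Arg c) = c"
    by (metis cis_Arg norm_zero sgn_div_norm inverse_1 scaleR_one zero_neq_one)
  show ?thesis
  proof
    fix t assume t: "t \<in> I"
    show "((\<lambda>t. Arg c + \<phi> t) has_real_derivative ?k t * norm (?v t)) (at t within I)"
      using \<phi>[OF t] by (auto intro!: derivative_eq_intros)
    have "c * cis (\<phi> t) = (1 / norm (?v t)) *\<^sub>R ?v t * (exp (- (\<i> * of_real (\<phi> t))) * exp (\<i> * of_real (\<phi> t)))"
      by (simp add: c[OF t, symmetric] u_def cis_conv_exp mult.assoc)
    then have "c * cis (\<phi> t) = (1 / norm (?v t)) *\<^sub>R ?v t"
      by (simp add: exp_minus_inverse mult.commute)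
    then show "?v t = of_real (norm (?v t)) * cis (Arg c + \<phi> t)"
      using nz[OF t] by (simp add: cis_c flip: cis_mult) (simp add: scaleR_conv_of_real)
  qed
qed

text \<open>A constant arclength derivative \<open>a\<close> means that
  \<open>g - a * \<sigma>\<close> has derivative 0 on an interval, hence is constant. The freedom in
  the choice of \<open>\<sigma>\<close> is absorbed by \<open>b\<close>.\<close>

lemma D_eq_multiple_of_speed_iff:
  assumes I: "nondeg_interval I" and arc: "arclength_parameter I f \<sigma>"
    and g: "\<And>t. t \<in> I \<Longrightarrow> g differentiable (at t within I)"
  shows "(\<forall>t\<in>I. D I g t = a * norm (D I f t)) \<longleftrightarrow> (\<exists>b. \<forall>t\<in>I. g t = a * \<sigma> t + b)"
proof -
  have \<sigma>: "(\<sigma> has_vector_derivative norm (D I f t)) (at t within I)" if "t \<in> I" for t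
    using arc that unfolding arclength_parameter_def has_real_derivative_iff_has_vector_derivative by blast
  show ?thesis
  proof
    assume *: "\<forall>t\<in>I. D I g t = a * norm (D I f t)"
    have "((\<lambda>t. g t - a * \<sigma> t) has_vector_derivative 0) (at t within I)" if "t \<in> I" for t
      using has_vector_derivative_diff[OF has_vector_derivative_D[OF g[OF that]]
          has_vector_derivative_mult_right[OF \<sigma>[OF that], of a]] * that by simp
    moreover have "convex I"
      using I is_interval_convex unfolding nondeg_interval_def by blast
    ultimately obtain b where "\<And>t. t \<in> I \<Longrightarrow> g t - a * \<sigma> t = b"
      using has_vector_derivative_zero_constant[of I "\<lambda>t. g t - a * \<sigma> t"] by blast
    then have "\<forall>t\<in>I. g t = a * \<sigma> t + b"
      by (simp add: algebra_simps)
    then show "\<exists>b. \<forall>t\<in>I. g t = a * \<sigma> t + b" ..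
  next
    assume "\<exists>b. \<forall>t\<in>I. g t = a * \<sigma> t + b"
    then obtain b where b: "\<And>t. t \<in> I \<Longrightarrow> g t = a * \<sigma> t + b" by blast
    show "\<forall>t\<in>I. D I g t = a * norm (D I f t)"
    proof
      fix t assume t: "t \<in> I"
      have "((\<lambda>t. a * \<sigma> t + b) has_vector_derivative a * norm (D I f t)) (at t within I)"
        by (rule has_vector_derivative_add_const[THEN iffD2, OF has_vector_derivative_mult_right[OF \<sigma>[OF t]]])
      then show "D I g t = a * norm (D I f t)"
        using has_vector_derivative_cong_on[of I g "\<lambda>t. a * \<sigma> t + b", OF b t]
        by (intro D_eqI[OF I t]) simp
    qed
  qed
qed

section \<open>Uniqueness of the lifted Lagrangian angle\<close>

text \<open>Cancelling the nonzero density shows that two lifts differ by a continuous function with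
  values in the multiples of 2 pi, which is constant on a connected domain. Thus the Laplacian of
  any lift can be found from one explicit lift.\<close>

lemma lagrangian_angle_unique:
  assumes conn: "connected (I \<times> J)"
    and nz: "\<And>t s. t \<in> I \<Longrightarrow> s \<in> J \<Longrightarrow> area_density I J \<Phi> t s \<noteq> 0"
    and "lagrangian_angle I J \<Phi> \<beta>" "lagrangian_angle I J \<Phi> \<gamma>"
  shows "\<exists>c. \<forall>t\<in>I. \<forall>s\<in>J. \<beta> t s = c + \<gamma> t s"
proof -
  let ?d = "\<lambda>z. \<beta> (fst z) (snd z) - \<gamma> (fst z) (snd z)"
  have cont: "continuous_on (I \<times> J) ?d"
    using assms(3,4) unfolding lagrangian_angle_def by (auto simp: case_prod_beta intro!: continuous_intros)
  have per: "\<exists>n::int. ?d z = 2 * pi * n" if "z \<in> I \<times> J" for z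
  proof -
    obtain t s where z: "z = (t, s)" "t \<in> I" "s \<in> J"
      using \<open>z \<in> I \<times> J\<close> by blast
    have "exp (\<i> * of_real (\<beta> t s)) * of_real (area_density I J \<Phi> t s)
        = exp (\<i> * of_real (\<gamma> t s)) * of_real (area_density I J \<Phi> t s)"
      using assms(3,4) z unfolding lagrangian_angle_def by metis
    then have "exp (\<i> * of_real (\<beta> t s)) = exp (\<i> * of_real (\<gamma> t s))"
      using nz z by simp
    then obtain n :: int where "\<i> * of_real (\<beta> t s) = \<i> * of_real (\<gamma> t s) + (of_int (2 * n) * pi) * \<i>"
      unfolding exp_eq by blast
    then have "\<beta> t s = \<gamma> t s + 2 * n * pi"
      by (simp add: complex_eq_iff)
    then show ?thesis
      using z by auto
  qed
  have "?d constant_on (I \<times> J)"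
  proof (rule continuous_discrete_range_constant[OF conn cont])
    fix z assume z: "z \<in> I \<times> J"
    \<comment> \<open>Distinct values of the difference are at least 2 pi apart; this is the uniform
      gap that the discreteness criterion asks for.\<close>
    have "2 * pi \<le> norm (?d w - ?d z)" if w: "w \<in> I \<times> J" and "?d w \<noteq> ?d z" for w
    proof -
      obtain m n :: int where mn: "?d w = 2 * pi * m" "?d z = 2 * pi * n"
        using per[OF w] per[OF z] by blast
      then have "m \<noteq> n"
        using \<open>?d w \<noteq> ?d z\<close> by auto
      then have "1 \<le> \<bar>real_of_int (m - n)\<bar>"
        by linarith
      then have "2 * pi * 1 \<le> 2 * pi * \<bar>real_of_int (m - n)\<bar>"
        by (intro mult_left_mono) auto
      also have "\<dots> = norm (?d w - ?d z)"
        unfolding mn real_norm_def by (simp add: abs_mult flip: right_diff_distrib)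
      finally show ?thesis by simp
    qed
    then show "\<exists>e>0. \<forall>w. w \<in> I \<times> J \<and> ?d w \<noteq> ?d z \<longrightarrow> e \<le> norm (?d w - ?d z)"
      by (intro exI[of _ "2 * pi"]) auto
  qed
  then obtain c where "\<And>z. z \<in> I \<times> J \<Longrightarrow> ?d z = c"
    unfolding constant_on_def by blast
  then have "\<beta> t s = c + \<gamma> t s" if "t \<in> I" "s \<in> J" for t s
    using that by (metis diff_add_cancel fst_conv mem_Sigma_iff snd_conv)
  then show ?thesis by blast
qed

section \<open>Induced geometry of the product of two curves\<close>

locale regular_curve_pair =
  fixes I J :: "real set" and \<alpha> \<omega> :: "real \<Rightarrow> complex" and t0 s0 :: real
  assumes I: "nondeg_interval I" and J: "nondeg_interval J"
    and reg_\<alpha>: "regular_curve I \<alpha>" and reg_\<omega>: "regular_curve J \<omega>"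
    and nz_\<alpha>: "\<And>t. t \<in> I \<Longrightarrow> \<alpha> t \<noteq> 0"
    and t0: "t0 \<in> I" and s0: "s0 \<in> J"
begin

abbreviation \<Phi> where "\<Phi> \<equiv> curve_product I J t0 s0 \<alpha> \<omega>"
abbreviation \<alpha>' where "\<alpha>' \<equiv> D I \<alpha>"
abbreviation \<omega>' where "\<omega>' \<equiv> D J \<omega>"

text \<open>The conformal factor of the induced metric relative to the product of the two curve
  metrics.\<close>

definition \<rho> where "\<rho> t s = (norm (\<alpha> t))\<^sup>2 + (norm (\<omega> s))\<^sup>2"

lemma rho_pos: "t \<in> I \<Longrightarrow> \<rho> t s > 0"
  using nz_\<alpha> by (simp add: \<rho>_def add_pos_nonneg)

lemma speed_pos: "t \<in> I \<Longrightarrow> norm (\<alpha>' t) > 0" "s \<in> J \<Longrightarrow> norm (\<omega>' s) > 0"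
  using reg_\<alpha> reg_\<omega> by (auto simp: regular_curve_def)

lemma smooth: "smooth_curve I \<alpha>" "smooth_curve J \<omega>"
  using reg_\<alpha> reg_\<omega> by (auto simp: regular_curve_def)

lemma smooth_integrands:
  "smooth_curve I (\<lambda>t. \<alpha>' t * cnj (\<alpha> t))" "smooth_curve J (\<lambda>s. \<omega>' s * cnj (\<omega> s))"
  using smooth smooth[THEN smooth_curve_D] I J
  by (auto intro!: smooth_curve_mult smooth_curve_bounded_linear[OF _ bounded_linear_cnj])

lemma first_component_derivatives:
  "t \<in> I \<Longrightarrow> ((\<lambda>t. - (LBINT x=ereal t0..ereal t. \<alpha>' x * cnj (\<alpha> x))) has_vector_derivative
     - (\<alpha>' t * cnj (\<alpha> t))) (at t within I)"
  "s \<in> J \<Longrightarrow> ((\<lambda>s. LBINT y=ereal s0..ereal s. \<omega>' y * cnj (\<omega> y)) has_vector_derivative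
     \<omega>' s * cnj (\<omega> s)) (at s within J)"
  using I J t0 s0 smooth_integrands[THEN smooth_curve_continuous_on] unfolding nondeg_interval_def
  by (auto intro!: has_vector_derivative_minus interval_lebesgue_integral_has_vector_derivative)

text \<open>Arranges the first component as a function of \<open>t\<close> plus a function of
  \<open>s\<close>, the shape required by \<open>smooth_map_separated\<close>; the minus sign goes
  into the first summand.\<close>

lemma Phi_eq:
  "\<Phi> = (\<lambda>t s. (- (LBINT x=ereal t0..ereal t. \<alpha>' x * cnj (\<alpha> x))
     + (LBINT y=ereal s0..ereal s. \<omega>' y * cnj (\<omega> y)), \<alpha> t * \<omega> s))"
  by (simp add: curve_product_def fun_eq_iff)

lemma smooth_Phi: "smooth_map I J \<Phi>"
proof -
  have "smooth_curve I (\<lambda>t. - (\<alpha>' t * cnj (\<alpha> t)))"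
    by (rule smooth_curve_bounded_linear[OF I bounded_linear_minus[OF bounded_linear_ident] smooth_integrands(1)])
  note 1 = smooth_curve_antiderivative[OF I this first_component_derivatives(1)]
  note 2 = smooth_curve_antiderivative[OF J smooth_integrands(2) first_component_derivatives(2)]
  show ?thesis
    unfolding Phi_eq by (rule smooth_map_separated[OF I J 1 2 smooth])
qed

lemma D1_Phi:
  assumes "t \<in> I"
  shows "D1 I \<Phi> t s = (- (\<alpha>' t * cnj (\<alpha> t)), \<alpha>' t * \<omega> s)"
proof -
  have "((\<lambda>t. \<Phi> t s) has_vector_derivative (- (\<alpha>' t * cnj (\<alpha> t)), \<alpha>' t * \<omega> s)) (at t within I)"
    unfolding Phi_eq
    by (rule has_vector_derivative_Pair[OF
          has_vector_derivative_add_const[THEN iffD2, OF first_component_derivatives(1)[OF assms]]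
          has_vector_derivative_mult_left[OF has_vector_derivative_D[OF
            smooth_curve_differentiable[OF smooth(1) assms]]]])
  then show ?thesis
    using D_eqI[OF I assms] by (simp add: D1_def D_def)
qed

lemma D2_Phi:
  assumes "s \<in> J"
  shows "D2 J \<Phi> t s = (\<omega>' s * cnj (\<omega> s), \<alpha> t * \<omega>' s)"
proof -
  have "((\<lambda>s. \<Phi> t s) has_vector_derivative (\<omega>' s * cnj (\<omega> s), \<alpha> t * \<omega>' s)) (at s within J)"
    unfolding Phi_eq
    using first_component_derivatives(2)[OF assms]
      has_vector_derivative_D[OF smooth_curve_differentiable[OF smooth(2) assms]]
    by (auto intro!: derivative_eq_intros has_vector_derivative_Pair)
  then show ?thesis
    using D_eqI[OF J assms] by (simp add: D2_def D_def)
qed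

lemma metric_E_Phi: "t \<in> I \<Longrightarrow> metric_E I J \<Phi> t s = (norm (\<alpha>' t))\<^sup>2 * \<rho> t s"
  by (simp add: metric_E_def D1_Phi inner_prod_def dot_square_norm norm_mult power_mult_distrib
      \<rho>_def distrib_left)

lemma metric_G_Phi: "s \<in> J \<Longrightarrow> metric_G I J \<Phi> t s = (norm (\<omega>' s))\<^sup>2 * \<rho> t s"
  by (simp add: metric_G_def D2_Phi inner_prod_def dot_square_norm norm_mult power_mult_distrib
      \<rho>_def algebra_simps)

text \<open>The two components contribute \<alpha>' cnj(\<alpha>) \<omega> cnj(\<omega>') with
  opposite signs to the Hermitian product of the partial derivatives. The vanishing real part is
  this claim; the vanishing imaginary part is the Lagrangian condition.\<close>

lemma metric_F_Phi: "t \<in> I \<Longrightarrow> s \<in> J \<Longrightarrow> metric_F I J \<Phi> t s = 0"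
  by (simp add: metric_F_def D1_Phi D2_Phi inner_prod_def inner_complex_def) algebra

lemma area_Phi:
  "t \<in> I \<Longrightarrow> s \<in> J \<Longrightarrow> area_density I J \<Phi> t s = norm (\<alpha>' t) * norm (\<omega>' s) * \<rho> t s"
proof -
  assume "t \<in> I" "s \<in> J"
  then have "metric_E I J \<Phi> t s * metric_G I J \<Phi> t s - (metric_F I J \<Phi> t s)\<^sup>2
      = (norm (\<alpha>' t) * norm (\<omega>' s) * \<rho> t s)\<^sup>2"
    by (simp add: metric_E_Phi metric_F_Phi metric_G_Phi power2_eq_square)
  then show ?thesis
    using rho_pos[OF \<open>t \<in> I\<close>, of s] by (simp add: area_density_def)
qed

lemma area_Phi_pos: "t \<in> I \<Longrightarrow> s \<in> J \<Longrightarrow> area_density I J \<Phi> t s > 0"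
  using rho_pos speed_pos by (simp add: area_Phi)

lemma lagrangian_immersion_Phi: "lagrangian_immersion I J \<Phi>"
proof -
  have "inj (\<lambda>(x, y). x *\<^sub>R D1 I \<Phi> t s + y *\<^sub>R D2 J \<Phi> t s)" if ts: "t \<in> I" "s \<in> J" for t s
  proof (rule injI, clarify)
    fix x y x' y' :: real
    let ?X = "D1 I \<Phi> t s" and ?Y = "D2 J \<Phi> t s"
    assume eq: "x *\<^sub>R ?X + y *\<^sub>R ?Y = x' *\<^sub>R ?X + y' *\<^sub>R ?Y"
    have E: "?X \<bullet> ?X > 0" and G: "?Y \<bullet> ?Y > 0" and F: "?X \<bullet> ?Y = 0"
      using metric_E_Phi[OF ts(1)] metric_G_Phi[OF ts(2)] metric_F_Phi[OF ts] rho_pos[OF ts(1)]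
        speed_pos ts unfolding metric_E_def metric_F_def metric_G_def by simp_all
    \<comment> \<open>By orthogonality, pairing with each tangent vector isolates one
      coefficient.\<close>
    have "x * (?X \<bullet> ?X) = x' * (?X \<bullet> ?X)" "y * (?Y \<bullet> ?Y) = y' * (?Y \<bullet> ?Y)"
      using arg_cong[OF eq, of "\<lambda>v. ?X \<bullet> v"] arg_cong[OF eq, of "\<lambda>v. v \<bullet> ?Y"] F
      by (simp_all add: inner_add_left inner_add_right)
    then show "x = x' \<and> y = y'"
      using E G by simp
  qed
  moreover have "kaehler_form (D1 I \<Phi> t s) (D2 J \<Phi> t s) = 0" if "t \<in> I" "s \<in> J" for t s
    using that by (simp add: kaehler_form_def D1_Phi D2_Phi)
  ultimately show ?thesis
    using smooth_Phi by (simp add: lagrangian_immersion_def immersion_def)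
qed

section \<open>The Laplacian of the Lagrangian angle\<close>

lemma laplacian_Phi:
  assumes \<beta>: "\<And>t s. t \<in> I \<Longrightarrow> s \<in> J \<Longrightarrow> \<beta> t s = \<theta> t + \<phi> s"
    and \<theta>: "\<And>t. t \<in> I \<Longrightarrow> (\<theta> has_real_derivative signed_curvature I \<alpha> t * norm (\<alpha>' t)) (at t within I)"
    and \<phi>: "\<And>s. s \<in> J \<Longrightarrow> (\<phi> has_real_derivative signed_curvature J \<omega> s * norm (\<omega>' s)) (at s within J)"
    and ts: "t \<in> I" "s \<in> J"
  shows "laplacian I J \<Phi> \<beta> t s =
    (norm (\<omega>' s) * D I (signed_curvature I \<alpha>) t + norm (\<alpha>' t) * D J (signed_curvature J \<omega>) s)
      / area_density I J \<Phi> t s"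
proof -
  have D1_\<beta>: "D1 I \<beta> x y = signed_curvature I \<alpha> x * norm (\<alpha>' x)" if "x \<in> I" "y \<in> J" for x y
  proof -
    have "((\<lambda>x. \<theta> x + \<phi> y) has_vector_derivative signed_curvature I \<alpha> x * norm (\<alpha>' x)) (at x within I)"
      using \<theta>[OF that(1)] unfolding has_real_derivative_iff_has_vector_derivative
      by (rule has_vector_derivative_add_const[THEN iffD2])
    then have "((\<lambda>x. \<beta> x y) has_vector_derivative signed_curvature I \<alpha> x * norm (\<alpha>' x)) (at x within I)"
      using has_vector_derivative_cong_on[of I "\<lambda>x. \<beta> x y" "\<lambda>x. \<theta> x + \<phi> y"] \<beta> that by blast
    then show ?thesis
      using D_eqI[OF I that(1)] by (simp add: D1_def D_def)
  qed
  have D2_\<beta>: "D2 J \<beta> x y = signed_curvature J \<omega> y * norm (\<omega>' y)" if "x \<in> I" "y \<in> J" for x y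
  proof -
    have "((\<lambda>y. \<phi> y + \<theta> x) has_vector_derivative signed_curvature J \<omega> y * norm (\<omega>' y)) (at y within J)"
      using \<phi>[OF that(2)] unfolding has_real_derivative_iff_has_vector_derivative
      by (rule has_vector_derivative_add_const[THEN iffD2])
    then have "((\<lambda>y. \<beta> x y) has_vector_derivative signed_curvature J \<omega> y * norm (\<omega>' y)) (at y within J)"
      using has_vector_derivative_cong_on[of J "\<lambda>y. \<beta> x y" "\<lambda>y. \<phi> y + \<theta> x"] \<beta> that by (simp add: add.commute)
    then show ?thesis
      using D_eqI[OF J that(2)] by (simp add: D2_def D_def)
  qed
  \<comment> \<open>Since F = 0, the quotient is the ratio of the speeds times the partial
    derivative of \<open>\<beta>\<close>. The factor \<open>\<rho>\<close> cancels, and the speed of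
    \<open>\<alpha>\<close> cancels against that in the derivative of \<open>\<theta>\<close>,
    leaving the curvature as the only factor that depends on \<open>x\<close>.\<close>
  have flux1: "(metric_G I J \<Phi> x s * D1 I \<beta> x s - metric_F I J \<Phi> x s * D2 J \<beta> x s) / area_density I J \<Phi> x s
      = norm (\<omega>' s) * signed_curvature I \<alpha> x" if "x \<in> I" for x
    using that ts speed_pos rho_pos[OF that, of s]
    by (simp add: metric_G_Phi metric_F_Phi area_Phi D1_\<beta> D2_\<beta> divide_simps power2_eq_square)
  have flux2: "(metric_E I J \<Phi> t y * D2 J \<beta> t y - metric_F I J \<Phi> t y * D1 I \<beta> t y) / area_density I J \<Phi> t y
      = norm (\<alpha>' t) * signed_curvature J \<omega> y" if "y \<in> J" for y
    using that ts speed_pos rho_pos[OF ts(1), of y]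
    by (simp add: metric_E_Phi metric_F_Phi area_Phi D1_\<beta> D2_\<beta> divide_simps power2_eq_square)
  \<comment> \<open>The instantiated definitions unfold only the outer derivative. The flux formula
    holds only on \<open>I\<close>, so it is inserted by congruence of derivatives within
    \<open>I\<close>.\<close>
  have "D1 I (\<lambda>t s. (metric_G I J \<Phi> t s * D1 I \<beta> t s - metric_F I J \<Phi> t s * D2 J \<beta> t s)
      / area_density I J \<Phi> t s) t s = D I (\<lambda>x. norm (\<omega>' s) * signed_curvature I \<alpha> x) t"
    unfolding D1_def[of I "\<lambda>t s. (metric_G I J \<Phi> t s * D1 I \<beta> t s - metric_F I J \<Phi> t s * D2 J \<beta> t s)
      / area_density I J \<Phi> t s"] D_def[of I "\<lambda>x. norm (\<omega>' s) * signed_curvature I \<alpha> x"]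
    by (rule vector_derivative_cong_on[OF flux1 ts(1)])
  moreover have "\<dots> = norm (\<omega>' s) * D I (signed_curvature I \<alpha>) t"
    using signed_curvature_differentiable[OF reg_\<alpha> ts(1)]
    by (intro D_eqI[OF I ts(1)] has_vector_derivative_mult_right has_vector_derivative_D)
  moreover have "D2 J (\<lambda>t s. (metric_E I J \<Phi> t s * D2 J \<beta> t s - metric_F I J \<Phi> t s * D1 I \<beta> t s)
      / area_density I J \<Phi> t s) t s = D J (\<lambda>y. norm (\<alpha>' t) * signed_curvature J \<omega> y) s"
    unfolding D2_def[of J "\<lambda>t s. (metric_E I J \<Phi> t s * D2 J \<beta> t s - metric_F I J \<Phi> t s * D1 I \<beta> t s)
      / area_density I J \<Phi> t s"] D_def[of J "\<lambda>y. norm (\<alpha>' t) * signed_curvature J \<omega> y"]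
    by (rule vector_derivative_cong_on[OF flux2 ts(2)])
  moreover have "\<dots> = norm (\<alpha>' t) * D J (signed_curvature J \<omega>) s"
    using signed_curvature_differentiable[OF reg_\<omega> ts(2)]
    by (intro D_eqI[OF J ts(2)] has_vector_derivative_mult_right has_vector_derivative_D)
  ultimately show ?thesis
    unfolding laplacian_def by presburger
qed

text \<open>An explicit lift settles existence, and all lifts have the same Laplacian, so the
  quantifier over lifts disappears. The nonzero density in the denominator does not affect
  vanishing.\<close>

lemma hamiltonian_stationary_iff:
  "hamiltonian_stationary_lagrangian I J \<Phi> \<longleftrightarrow>
    (\<forall>t\<in>I. \<forall>s\<in>J. norm (\<omega>' s) * D I (signed_curvature I \<alpha>) t
                 + norm (\<alpha>' t) * D J (signed_curvature J \<omega>) s = 0)"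
proof -
  obtain \<theta> where \<theta>: "\<And>t. t \<in> I \<Longrightarrow> (\<theta> has_real_derivative signed_curvature I \<alpha> t * norm (\<alpha>' t)) (at t within I)"
    and \<alpha>': "\<And>t. t \<in> I \<Longrightarrow> \<alpha>' t = of_real (norm (\<alpha>' t)) * cis (\<theta> t)"
    using tangent_angle_exists[OF I reg_\<alpha>] by metis
  obtain \<phi> where \<phi>: "\<And>s. s \<in> J \<Longrightarrow> (\<phi> has_real_derivative signed_curvature J \<omega> s * norm (\<omega>' s)) (at s within J)"
    and \<omega>': "\<And>s. s \<in> J \<Longrightarrow> \<omega>' s = of_real (norm (\<omega>' s)) * cis (\<phi> s)"
    using tangent_angle_exists[OF J reg_\<omega>] by metis
  \<comment> \<open>The summand \<open>pi\<close> accounts for the minus sign in the pulled-back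
    volume form -\<alpha>' \<omega>' \<rho>.\<close>
  let ?\<gamma> = "\<lambda>t s. pi + \<theta> t + \<phi> s"
  have angle: "lagrangian_angle I J \<Phi> ?\<gamma>"
    unfolding lagrangian_angle_def
  proof (intro conjI ballI)
    have "continuous_on I \<theta>" "continuous_on J \<phi>"
      by (rule DERIV_continuous_on, erule \<theta>) (rule DERIV_continuous_on, erule \<phi>)
    then show "continuous_on (I \<times> J) (\<lambda>(t, s). ?\<gamma> t s)"
      by (auto simp: case_prod_beta intro!: continuous_intros
          continuous_on_compose2[of I \<theta>] continuous_on_compose2[of J \<phi>])
    fix t s assume ts: "t \<in> I" "s \<in> J"
    have "complex_volume_form (D1 I \<Phi> t s) (D2 J \<Phi> t s)
        = - (\<alpha>' t * \<omega>' s) * (\<alpha> t * cnj (\<alpha> t) + \<omega> s * cnj (\<omega> s))"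
      by (simp add: complex_volume_form_def D1_Phi D2_Phi ts algebra_simps)
    also have "\<alpha> t * cnj (\<alpha> t) + \<omega> s * cnj (\<omega> s) = of_real (\<rho> t s)"
      by (simp only: \<rho>_def of_real_add complex_norm_square)
    also have "- (\<alpha>' t * \<omega>' s) = of_real (norm (\<alpha>' t) * norm (\<omega>' s)) * cis (?\<gamma> t s)"
      by (subst \<alpha>'[OF ts(1)], subst \<omega>'[OF ts(2)]) (simp flip: cis_mult)
    finally show "complex_volume_form (D1 I \<Phi> t s) (D2 J \<Phi> t s)
        = exp (\<i> * of_real (?\<gamma> t s)) * of_real (area_density I J \<Phi> t s)"
      by (simp add: area_Phi ts cis_conv_exp)
  qed
  have pos: "area_density I J \<Phi> t s \<noteq> 0" if "t \<in> I" "s \<in> J" for t s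
    using area_Phi_pos[OF that] by simp
  have lap: "laplacian I J \<Phi> \<beta> t s =
      (norm (\<omega>' s) * D I (signed_curvature I \<alpha>) t + norm (\<alpha>' t) * D J (signed_curvature J \<omega>) s)
        / area_density I J \<Phi> t s"
    if "lagrangian_angle I J \<Phi> \<beta>" "t \<in> I" "s \<in> J" for \<beta> t s
  proof -
    have "connected (I \<times> J)"
      using I J unfolding nondeg_interval_def by (simp add: connected_Times is_interval_connected)
    from lagrangian_angle_unique[OF this pos that(1) angle]
    obtain c where c: "\<forall>t\<in>I. \<forall>s\<in>J. \<beta> t s = c + ?\<gamma> t s"
      by blast
    show ?thesis
    \<comment> \<open>The constants \<open>c\<close> and \<open>pi\<close> are put into the summand
      depending on \<open>t\<close>, whose derivative they do not change.\<close>
    proof (rule laplacian_Phi[OF _ _ \<phi> that(2,3)])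
      show "\<beta> t s = (c + pi + \<theta> t) + \<phi> s" if "t \<in> I" "s \<in> J" for t s
        using c that by simp
      show "((\<lambda>t. c + pi + \<theta> t) has_real_derivative signed_curvature I \<alpha> t * norm (\<alpha>' t)) (at t within I)"
        if "t \<in> I" for t
        using \<theta>[OF that] by (auto intro!: derivative_eq_intros)
    qed
  qed
  have "(\<forall>t\<in>I. \<forall>s\<in>J. laplacian I J \<Phi> \<beta> t s = 0) \<longleftrightarrow>
      (\<forall>t\<in>I. \<forall>s\<in>J. norm (\<omega>' s) * D I (signed_curvature I \<alpha>) t
                   + norm (\<alpha>' t) * D J (signed_curvature J \<omega>) s = 0)"
    if "lagrangian_angle I J \<Phi> \<beta>" for \<beta>
    by (simp add: lap[OF that] pos)
  with lagrangian_immersion_Phi angle show ?thesis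
    unfolding hamiltonian_stationary_lagrangian_def by blast
qed

end

section \<open>Separation of variables in the stationarity equation\<close>

theorem corollary3p3:
  fixes I J :: "real set" and \<alpha> \<omega> :: "real \<Rightarrow> complex"
    and t0 s0 :: real and \<sigma> \<tau> :: "real \<Rightarrow> real"
  assumes "nondeg_interval I" and "nondeg_interval J"
    and "regular_curve I \<alpha>" and "regular_curve J \<omega>"
    and "\<forall>t\<in>I. \<alpha> t \<noteq> 0" and "\<forall>s\<in>J. \<omega> s \<noteq> 0"
    and "t0 \<in> I" and "s0 \<in> J"
    and "arclength_parameter I \<alpha> \<sigma>" and "arclength_parameter J \<omega> \<tau>"
  shows "hamiltonian_stationary_lagrangian I J (curve_product I J t0 s0 \<alpha> \<omega>) \<longleftrightarrow>
    (\<exists>a b c :: real.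
       (\<forall>t\<in>I. signed_curvature I \<alpha> t = a * \<sigma> t + b) \<and>
       (\<forall>s\<in>J. signed_curvature J \<omega> s = - a * \<tau> s + c))"
proof -
  interpret regular_curve_pair I J \<alpha> \<omega> t0 s0
    using assms by unfold_locales auto
  let ?k = "D I (signed_curvature I \<alpha>)" and ?l = "D J (signed_curvature J \<omega>)"
  have "(\<forall>t\<in>I. \<forall>s\<in>J. norm (\<omega>' s) * ?k t + norm (\<alpha>' t) * ?l s = 0) \<longleftrightarrow>
      (\<exists>a. (\<forall>t\<in>I. ?k t = a * norm (\<alpha>' t)) \<and> (\<forall>s\<in>J. ?l s = - a * norm (\<omega>' s)))"
    (is "?L \<longleftrightarrow> ?R")
  proof
    assume L: ?L
    \<comment> \<open>The separation constant is the arclength derivative of the first curvature at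
      \<open>t0\<close>. Freezing \<open>t = t0\<close> gives the law for \<open>?l\<close> at every
      \<open>s\<close>; freezing \<open>s = s0\<close> then gives the law for \<open>?k\<close> at
      every \<open>t\<close>.\<close>
    define a where "a = ?k t0 / norm (\<alpha>' t0)"
    have l: "?l s = - a * norm (\<omega>' s)" if "s \<in> J" for s
      using bspec[OF bspec[OF L t0] that] speed_pos(1)[OF t0] by (simp add: a_def field_simps)
    have "?k t = a * norm (\<alpha>' t)" if "t \<in> I" for t
    proof -
      have "norm (\<omega>' s0) * (?k t - a * norm (\<alpha>' t)) = 0"
        using bspec[OF bspec[OF L that] s0] l[OF s0] by (simp add: algebra_simps)
      then show ?thesis
        using speed_pos(2)[OF s0] by simp
    qed
    with l show ?R by blast
  next
    assume ?R
    then show ?L by auto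
  qed
  moreover have "(\<forall>t\<in>I. ?k t = a * norm (\<alpha>' t)) \<longleftrightarrow> (\<exists>b. \<forall>t\<in>I. signed_curvature I \<alpha> t = a * \<sigma> t + b)" for a
    by (intro D_eq_multiple_of_speed_iff I assms(9) signed_curvature_differentiable reg_\<alpha>)
  \<comment> \<open>Stated for every \<open>a\<close>, hence available at \<open>- a\<close>, the
    slope of the second curvature.\<close>
  moreover have "(\<forall>s\<in>J. ?l s = a * norm (\<omega>' s)) \<longleftrightarrow> (\<exists>c. \<forall>s\<in>J. signed_curvature J \<omega> s = a * \<tau> s + c)" for a
    by (intro D_eq_multiple_of_speed_iff J assms(10) signed_curvature_differentiable reg_\<omega>)
  ultimately show ?thesis
    unfolding hamiltonian_stationary_iff by (simp only:) blast
qed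

end
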